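(* For each $t\ge1$ and each $k\ge 1$ there exists a $t$-PDDS in $\Lambda_2$ all of whose components are isomorphic to $P_2\square P_k$.
   Context: $\Lambda_2$ is the infinite graph with vertex set $\mathbb{Z}^2$ in which two vertices are adjacent iff their Euclidean distance is $1$; $d$ denotes graph distance. For $S$ a set of vertices, $[S]$ is the induced subgraph and $d(v,C)=\min\{d(v,w):w\in C\}$. For $t\ge1$, $S$ is a $t$-perfect distance-dominating set ($t$-PDDS) if for each vertex $v$ there is a unique component $C_v$ of $[S]$ with $d(v,C_v)\le t$, and there is in $C_v$ a unique vertex $w$ with $d(v,w)=d(v,C_v)$. $P_k$ is the path on $k$ vertices and $\square$ is the Cartesian product of graphs. *)

theory Defs
  imports "HOL-Analysis.Product_Vector" "Graph_Theory.Graph_Theory"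
begin

text \<open>
  Undirected graphs are modelled, as in \<open>Graph_Theory\<close>, by symmetric loop-free digraphs, each edge
  being a pair of opposite arcs. For these, the strongly connected components
  \<open>pre_digraph.sccs\<close> are the connected components (maximal connected subgraphs).
\<close>

text \<open>The metric on \<^typ>\<open>real \<times> real\<close> is the Euclidean one.\<close>

definition Lambda2 :: "(int \<times> int) pair_pre_digraph" where
  "Lambda2 = \<lparr> pverts = UNIV,
     parcs = {((a, b), (c, d)).
       dist (real_of_int a, real_of_int b) (real_of_int c, real_of_int d) = 1} \<rparr>"

lemma pair_bidirected_digraph_Lambda2: "pair_bidirected_digraph Lambda2"
  by unfold_locales
    (auto simp: Lambda2_def symmetric_def sym_def dist_commute)

definition path_graph :: "nat \<Rightarrow> nat pair_pre_digraph" where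
  "path_graph k = \<lparr> pverts = {..<k},
     parcs = {(i, j). i < k \<and> j < k \<and> (j = Suc i \<or> i = Suc j)} \<rparr>"

definition cartesian_product ::
  "'a pair_pre_digraph \<Rightarrow> 'b pair_pre_digraph \<Rightarrow> ('a \<times> 'b) pair_pre_digraph" (infixr \<open>\<box>\<close> 70) where
  "G \<box> H = \<lparr> pverts = pverts G \<times> pverts H,
     parcs = {((a, b), (c, d)).
       (a = c \<and> a \<in> pverts G \<and> (b, d) \<in> parcs H) \<or>
       (b = d \<and> b \<in> pverts H \<and> (a, c) \<in> parcs G)} \<rparr>"

text \<open>
  The graph distance is the length of a shortest walk, i.e.\ the shortest-path distance for unit
  weights (\<open>\<infinity>\<close> if there is no walk).
\<close>

definition graph_dist :: "('a, 'b) pre_digraph \<Rightarrow> 'a \<Rightarrow> 'a \<Rightarrow> ereal" where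
  "graph_dist G u v = wf_digraph.\<mu> G (\<lambda>_. 1) u v"

text \<open>
  The infimum is a minimum for nonempty \<open>C\<close>, as distances lie in
  \<open>\<nat> \<union> {\<infinity>}\<close>. Distances are measured in the ambient graph \<open>G\<close>, not in \<open>C\<close>.
\<close>

definition graph_setdist :: "('a, 'b) pre_digraph \<Rightarrow> 'a \<Rightarrow> 'a set \<Rightarrow> ereal" where
  "graph_setdist G v C = (INF w\<in>C. graph_dist G v w)"

definition PDDS :: "('a, 'b) pre_digraph \<Rightarrow> nat \<Rightarrow> 'a set \<Rightarrow> bool" where
  "PDDS G t S \<longleftrightarrow> S \<subseteq> verts G \<and>
     (\<forall>v \<in> verts G.
        (\<exists>!C. C \<in> pre_digraph.sccs (G \<restriction> S) \<and> graph_setdist G v (verts C) \<le> ereal (real t)) \<and>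
        (\<forall>C \<in> pre_digraph.sccs (G \<restriction> S). graph_setdist G v (verts C) \<le> ereal (real t) \<longrightarrow>
           (\<exists>!w. w \<in> verts C \<and> graph_dist G v w = graph_setdist G v (verts C))))"

end

theory Submission
  imports Defs
begin

text \<open>
  Take the \<open>2 \<times> k\<close> rectangles with lower left corners \<open>(p (t + 1), n (k + t))\<close>, \<open>p + n\<close> even. The graph
  distance is the \<open>\<ell>\<^sub>1\<close>-distance, so every vertex has a unique nearest point in a rectangle, namely
  its coordinatewise projection. The \<open>t\<close>-neighbourhood of a rectangle is a hexagon-like region with
  staircase sides, and these regions tile the plane: those with a fixed \<open>n\<close> form a strip with zigzag
  boundaries, and the strip for \<open>n + 1\<close>, shifted by half a period, fits on top of it. As \<open>t \<ge> 1\<close>,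
  disjointness of the regions also shows that distinct rectangles are not adjacent, so the
  rectangles are the components.
\<close>

section \<open>The graph distance of the square grid\<close>

definition l1_dist :: "int \<times> int \<Rightarrow> int \<times> int \<Rightarrow> int" where
  "l1_dist u v = \<bar>fst u - fst v\<bar> + \<bar>snd u - snd v\<bar>"

lemma l1_dist_triangle: "l1_dist u w \<le> l1_dist u v + l1_dist v w"
  by (simp add: l1_dist_def)

lemma l1_dist_nonneg: "0 \<le> l1_dist u v"
  by (simp add: l1_dist_def)

lemma l1_dist_commute: "l1_dist u v = l1_dist v u"
  by (simp add: l1_dist_def)

text \<open>Over the integers both sides force one coordinate to be 0 and the other to be 1 or -1.
  This turns Euclidean adjacency into an \<open>l1_dist\<close> condition.\<close>

lemma int_sum_squares_eq_1_iff:
  fixes x y :: int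
  shows "x\<^sup>2 + y\<^sup>2 = 1 \<longleftrightarrow> \<bar>x\<bar> + \<bar>y\<bar> = 1"
proof
  assume *: "x\<^sup>2 + y\<^sup>2 = 1"
  have "\<bar>x\<bar> \<le> 1" "\<bar>y\<bar> \<le> 1"
    using * by (metis abs_square_le_1 le_add_same_cancel1 zero_le_power2)
      (metis * abs_square_le_1 le_add_same_cancel2 zero_le_power2)
  then have "x \<in> {-1, 0, 1}" "y \<in> {-1, 0, 1}"
    by auto
  then show "\<bar>x\<bar> + \<bar>y\<bar> = 1"
    using * by auto
next
  assume *: "\<bar>x\<bar> + \<bar>y\<bar> = 1"
  then have "x \<in> {-1, 0, 1}" "y \<in> {-1, 0, 1}"
    by auto
  then show "x\<^sup>2 + y\<^sup>2 = 1"
    using * by auto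
qed

lemma pverts_Lambda2 [simp]: "pverts Lambda2 = UNIV"
  by (simp add: Lambda2_def)

lemma in_parcs_Lambda2_iff: "(u, v) \<in> parcs Lambda2 \<longleftrightarrow> l1_dist u v = 1"
proof -
  obtain a b c d where uv: "u = (a, b)" "v = (c, d)"
    by (cases u, cases v)
  have "(u, v) \<in> parcs Lambda2 \<longleftrightarrow>
      (real_of_int a - real_of_int c)\<^sup>2 + (real_of_int b - real_of_int d)\<^sup>2 = 1"
    by (simp add: uv Lambda2_def dist_Pair_Pair dist_real_def)
  also have "\<dots> \<longleftrightarrow> real_of_int ((a - c)\<^sup>2 + (b - d)\<^sup>2) = real_of_int 1"
    by simp
  also have "\<dots> \<longleftrightarrow> l1_dist u v = 1"
    unfolding of_int_eq_iff by (simp add: int_sum_squares_eq_1_iff uv l1_dist_def)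
  finally show ?thesis .
qed

interpretation Lambda2: pair_bidirected_digraph Lambda2
  by (rule pair_bidirected_digraph_Lambda2)

text \<open>Move one unit towards \<open>v\<close>, horizontally unless the columns already agree.
  Such a step stays inside any rectangle containing both points, so the lemma serves walks in the
  whole grid as well as connectivity inside a block.\<close>

lemma l1_dist_step:
  assumes "u \<noteq> v"
  obtains w where "l1_dist u w = 1" "l1_dist w v = l1_dist u v - 1"
    "u \<in> {a..c} \<times> {b..d} \<Longrightarrow> v \<in> {a..c} \<times> {b..d} \<Longrightarrow> w \<in> {a..c} \<times> {b..d}"
proof (cases "fst u = fst v")
  case True
  with assms have ne: "snd u \<noteq> snd v"
    by (simp add: prod_eq_iff)
  show ?thesis
  proof (rule that[of "(fst u, snd u + sgn (snd v - snd u))"])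
  qed (use True ne in \<open>auto simp: l1_dist_def sgn_if\<close>)
next
  case False
  show ?thesis
  proof (rule that[of "(fst u + sgn (fst v - fst u), snd u)"])
  qed (use False in \<open>auto simp: l1_dist_def sgn_if\<close>)
qed

text \<open>By the triangle inequality, one arc lowers the \<open>l1_dist\<close> to the target by
  at most 1.\<close>

lemma awalk_cost_Lambda2_ge:
  assumes "Lambda2.awalk u p v"
  shows "real_of_int (l1_dist u v) \<le> Lambda2.awalk_cost (\<lambda>_. 1) p"
  using assms
proof (induction p arbitrary: u)
  case Nil
  then show ?case
    by (simp add: Lambda2.awalk_Nil_iff l1_dist_def)
next
  case (Cons e p)
  then have e: "l1_dist u (snd e) = 1" and p: "Lambda2.awalk (snd e) p v"
    using in_parcs_Lambda2_iff[of "fst e" "snd e"] by (auto simp: Lambda2.awalk_Cons_iff)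
  have "real_of_int (l1_dist u v) \<le> real_of_int (1 + l1_dist (snd e) v)"
    unfolding of_int_le_iff using l1_dist_triangle[of u v "snd e"] e by simp
  then show ?case
    using Cons.IH[OF p] by simp
qed

text \<open>Iterating \<open>l1_dist_step\<close> gives a walk meeting the lower bound, so the
  infimum defining the graph distance is attained.\<close>

lemma Lambda2_awalk_exists:
  "\<exists>p. Lambda2.awalk u p v \<and> Lambda2.awalk_cost (\<lambda>_. 1) p = real_of_int (l1_dist u v)"
proof (induction "nat (l1_dist u v)" arbitrary: u rule: less_induct)
  case less
  show ?case
  proof (cases "u = v")
    case True
    then show ?thesis
      by (intro exI[of _ "[]"]) (simp add: Lambda2.awalk_Nil_iff l1_dist_def)
  next
    case False
    then obtain w where w: "l1_dist u w = 1" "l1_dist w v = l1_dist u v - 1"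
      by (rule l1_dist_step) blast
    then have "nat (l1_dist w v) < nat (l1_dist u v)"
      using l1_dist_nonneg[of w v] by simp
    then obtain p where "Lambda2.awalk w p v"
      "Lambda2.awalk_cost (\<lambda>_. 1) p = real_of_int (l1_dist w v)"
      using less.hyps by blast
    then show ?thesis
      using w by (intro exI[of _ "(u, w) # p"])
        (simp add: Lambda2.awalk_Cons_iff in_parcs_Lambda2_iff)
  qed
qed

lemma graph_dist_Lambda2:
  "graph_dist (with_proj Lambda2) u v = ereal (real_of_int (l1_dist u v))"
proof -
  obtain p where p: "Lambda2.awalk u p v"
    "Lambda2.awalk_cost (\<lambda>_. 1) p = real_of_int (l1_dist u v)"
    using Lambda2_awalk_exists by blast
  show ?thesis
    unfolding graph_dist_def Lambda2.\<mu>_def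
  proof (rule antisym)
    show "(INF p\<in>{p. Lambda2.awalk u p v}. ereal (Lambda2.awalk_cost (\<lambda>_. 1) p))
        \<le> ereal (real_of_int (l1_dist u v))"
      using p by (intro INF_lower2[of p]) auto
    show "ereal (real_of_int (l1_dist u v))
        \<le> (INF p\<in>{p. Lambda2.awalk u p v}. ereal (Lambda2.awalk_cost (\<lambda>_. 1) p))"
      using awalk_cost_Lambda2_ge by (intro INF_greatest) auto
  qed
qed

section \<open>Distance to a rectangle\<close>

text \<open>For \<open>a \<le> c\<close> this is the distance from \<open>x\<close> to
  \<open>{a..c}\<close>. The closed form keeps later arguments within linear arithmetic.\<close>

definition interval_dist :: "int \<Rightarrow> int \<Rightarrow> int \<Rightarrow> int" where
  "interval_dist a c x = max 0 (max (a - x) (x - c))"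

text \<open>The distance is a sum over the coordinates, and clamping minimises each summand
  strictly; any other point is worse in some coordinate and better in none.\<close>

lemma rectangle_projection:
  assumes "a \<le> c" "b \<le> d"
  obtains w where "w \<in> {a..c} \<times> {b..d}"
    "l1_dist v w = interval_dist a c (fst v) + interval_dist b d (snd v)"
    "\<And>w'. w' \<in> {a..c} \<times> {b..d} \<Longrightarrow> w' \<noteq> w \<Longrightarrow> l1_dist v w < l1_dist v w'"
proof -
  let ?w = "(max a (min c (fst v)), max b (min d (snd v)))"
  have "l1_dist v ?w < l1_dist v w'" if "w' \<in> {a..c} \<times> {b..d}" "w' \<noteq> ?w" for w'
  proof (cases w')
    case (Pair x y)
    have "max a (min c (fst v)) \<noteq> x \<or> max b (min d (snd v)) \<noteq> y"
      using that Pair by auto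
    moreover have "\<bar>fst v - max a (min c (fst v))\<bar> \<le> \<bar>fst v - x\<bar>"
      "\<bar>snd v - max b (min d (snd v))\<bar> \<le> \<bar>snd v - y\<bar>"
      using that Pair assms by auto
    moreover have "\<bar>fst v - max a (min c (fst v))\<bar> < \<bar>fst v - x\<bar>"
      if "max a (min c (fst v)) \<noteq> x"
      using that \<open>w' \<in> _\<close> Pair assms by (auto simp: max_def min_def abs_if split: if_splits)
    moreover have "\<bar>snd v - max b (min d (snd v))\<bar> < \<bar>snd v - y\<bar>"
      if "max b (min d (snd v)) \<noteq> y"
      using that \<open>w' \<in> _\<close> Pair assms by (auto simp: max_def min_def abs_if split: if_splits)
    ultimately show ?thesis
      unfolding l1_dist_def Pair fst_conv snd_conv by linarith
  qed
  moreover have "?w \<in> {a..c} \<times> {b..d}"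
    using assms by auto
  moreover have "l1_dist v ?w = interval_dist a c (fst v) + interval_dist b d (snd v)"
  proof -
    have "\<bar>fst v - max a (min c (fst v))\<bar> = interval_dist a c (fst v)"
      "\<bar>snd v - max b (min d (snd v))\<bar> = interval_dist b d (snd v)"
      using assms by (auto simp: interval_dist_def)
    then show ?thesis
      by (simp add: l1_dist_def)
  qed
  ultimately show ?thesis
    using that by blast
qed

lemma
  assumes "a \<le> c" "b \<le> d"
  shows graph_setdist_rectangle:
      "graph_setdist (with_proj Lambda2) v ({a..c} \<times> {b..d}) =
        ereal (real_of_int (interval_dist a c (fst v) + interval_dist b d (snd v)))" (is ?dist)
    and rectangle_unique_nearest:
      "\<exists>!w. w \<in> {a..c} \<times> {b..d} \<and> graph_dist (with_proj Lambda2) v w =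
        graph_setdist (with_proj Lambda2) v ({a..c} \<times> {b..d})" (is ?unique)
proof -
  obtain w where w: "w \<in> {a..c} \<times> {b..d}"
    and dist: "l1_dist v w = interval_dist a c (fst v) + interval_dist b d (snd v)"
    and less: "\<And>w'. w' \<in> {a..c} \<times> {b..d} \<Longrightarrow> w' \<noteq> w \<Longrightarrow> l1_dist v w < l1_dist v w'"
    using rectangle_projection[OF assms, of v] by blast
  have eq: "graph_setdist (with_proj Lambda2) v ({a..c} \<times> {b..d}) =
      ereal (real_of_int (l1_dist v w))"
    unfolding graph_setdist_def graph_dist_Lambda2
  proof (rule antisym)
    show "(INF w\<in>{a..c} \<times> {b..d}. ereal (real_of_int (l1_dist v w)))
        \<le> ereal (real_of_int (l1_dist v w))"
      using w by (rule INF_lower)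
    show "ereal (real_of_int (l1_dist v w))
        \<le> (INF w\<in>{a..c} \<times> {b..d}. ereal (real_of_int (l1_dist v w)))"
      using less by (intro INF_greatest) (force simp: le_less)
  qed
  then show ?dist
    by (simp only: dist)
  show ?unique
    unfolding eq graph_dist_Lambda2 using w less by (intro ex1I[of _ w]) fastforce+
qed

section \<open>Components\<close>

text \<open>A set closed under adjacency is closed under reachability. Being also mutually
  reachable, each block is exactly the component of each of its points.\<close>

lemma sccs_eq_blocks:
  assumes "wf_digraph G"
    and cover: "verts G = \<Union>\<B>"
    and nonempty: "{} \<notin> \<B>"
    and connected: "\<And>B u v. B \<in> \<B> \<Longrightarrow> u \<in> B \<Longrightarrow> v \<in> B \<Longrightarrow> u \<rightarrow>\<^sup>*\<^bsub>G\<^esub> v"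
    and closed: "\<And>B u v. B \<in> \<B> \<Longrightarrow> u \<in> B \<Longrightarrow> u \<rightarrow>\<^bsub>G\<^esub> v \<Longrightarrow> v \<in> B"
  shows "pre_digraph.sccs G = (\<lambda>B. G \<restriction> B) ` \<B>"
proof -
  interpret wf_digraph G by fact
  have reach: "v \<in> B" if "u \<rightarrow>\<^sup>*\<^bsub>G\<^esub> v" "B \<in> \<B>" "u \<in> B" for u v B
    using that by (induction rule: reachable_induct) (auto intro: closed)
  have scc_of: "scc_of u = B" if "B \<in> \<B>" "u \<in> B" for u B
    using that connected reach unfolding scc_of_def by blast
  have "sccs_verts = \<B>"
    unfolding sccs_verts_conv_scc_of
  proof (intro subset_antisym subsetI)
    fix B assume "B \<in> scc_of ` verts G"
    then show "B \<in> \<B>"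
      using scc_of cover by auto
  next
    fix B assume B: "B \<in> \<B>"
    then obtain u where u: "u \<in> B"
      using nonempty by (metis all_not_in_conv)
    with B have "u \<in> verts G"
      using cover by blast
    then show "B \<in> scc_of ` verts G"
      using scc_of[OF B u] by blast
  qed
  then show ?thesis
    by (simp add: sccs_conv_sccs_verts)
qed

lemma adj_induce_Lambda2_iff:
  "u \<rightarrow>\<^bsub>with_proj Lambda2 \<restriction> S\<^esub> v \<longleftrightarrow> u \<in> S \<and> v \<in> S \<and> l1_dist u v = 1"
  by (auto simp: arcs_ends_conv induce_subgraph_def image_iff simp flip: in_parcs_Lambda2_iff)

lemma rectangle_reachable:
  assumes sub: "{a..c} \<times> {b..d} \<subseteq> S"
    and "u \<in> {a..c} \<times> {b..d}" "v \<in> {a..c} \<times> {b..d}"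
  shows "u \<rightarrow>\<^sup>*\<^bsub>with_proj Lambda2 \<restriction> S\<^esub> v"
  using assms(2,3)
proof (induction "nat (l1_dist u v)" arbitrary: u rule: less_induct)
  case less
  interpret wf_digraph "with_proj Lambda2 \<restriction> S"
    by (rule Lambda2.wellformed_induce_subgraph)
  show ?case
  proof (cases "u = v")
    case True
    then show ?thesis
      using less.prems sub by auto
  next
    case False
    then obtain w where w: "l1_dist u w = 1" "l1_dist w v = l1_dist u v - 1"
      "u \<in> {a..c} \<times> {b..d} \<Longrightarrow> v \<in> {a..c} \<times> {b..d} \<Longrightarrow> w \<in> {a..c} \<times> {b..d}"
      using l1_dist_step[of u v a c b d] by metis
    then have w': "w \<in> {a..c} \<times> {b..d}" "nat (l1_dist w v) < nat (l1_dist u v)"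
      using l1_dist_nonneg[of w v] less.prems by auto
    then have "w \<rightarrow>\<^sup>*\<^bsub>with_proj Lambda2 \<restriction> S\<^esub> v"
      using less by blast
    moreover have "u \<rightarrow>\<^bsub>with_proj Lambda2 \<restriction> S\<^esub> w"
      using w(1) w'(1) less.prems sub by (auto simp: adj_induce_Lambda2_iff)
    ultimately show ?thesis
      by (rule adj_reachable_trans[rotated])
  qed
qed

text \<open>Translate the lower left corner to the origin. Points at \<open>l1_dist\<close> 1 agree
  in one coordinate and differ by 1 in the other, which is adjacency in a product of paths.\<close>

lemma rectangle_iso_path_product:
  "digraph_iso (with_proj Lambda2 \<restriction> ({a..a + int m - 1} \<times> {b..b + int n - 1}))
     (with_proj (path_graph m \<box> path_graph n))"
proof -
  let ?R = "{a..a + int m - 1} \<times> {b..b + int n - 1}"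
  let ?G = "with_proj Lambda2 \<restriction> ?R"
  define g where "g = (\<lambda>(i, j). (a + int i, b + int j))"
  \<comment> \<open>\<open>nat\<close> sends negative numbers to 0, but on \<open>?R\<close> both
    differences are nonnegative, so nothing is lost and \<open>g\<close> inverts \<open>f\<close>
    there.\<close>
  define f where "f = (\<lambda>(x, y). (nat (x - a), nat (y - b)))"
  define h where "h = \<lparr>iso_verts = f, iso_arcs = map_prod f f, iso_head = snd, iso_tail = fst\<rparr>"
  have gf: "g (f u) = u" if "u \<in> ?R" for u
    using that by (auto simp: g_def f_def)
  have inj: "inj_on f ?R"
    by (rule inj_on_inverseI) (rule gf)
  have arcs: "arcs ?G = {(u, v). u \<in> ?R \<and> v \<in> ?R \<and> l1_dist u v = 1}"
    by (auto simp: induce_subgraph_def in_parcs_Lambda2_iff)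
  have verts_eq: "f ` ?R = {..<m} \<times> {..<n}"
  proof (intro subset_antisym subsetI)
    fix u assume "u \<in> {..<m} \<times> {..<n}"
    then have "g u \<in> ?R" "f (g u) = u"
      by (auto simp: g_def f_def)
    then show "u \<in> f ` ?R"
      by (metis image_eqI)
  qed (auto simp: f_def)
  have adj: "(f u, f v) \<in> parcs (path_graph m \<box> path_graph n) \<longleftrightarrow> l1_dist u v = 1"
    if "u \<in> ?R" "v \<in> ?R" for u v
  proof -
    have "f u \<in> {..<m} \<times> {..<n}" "f v \<in> {..<m} \<times> {..<n}"
      using that verts_eq by blast+
    then obtain i j i' j' where *: "f u = (i, j)" "f v = (i', j')" "i < m" "j < n" "i' < m" "j' < n"
      by blast
    then have "u = (a + int i, b + int j)" "v = (a + int i', b + int j')"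
      using that gf[of u] gf[of v] by (simp_all add: g_def)
    then have "l1_dist u v = \<bar>int i - int i'\<bar> + \<bar>int j - int j'\<bar>"
      by (simp add: l1_dist_def)
    also have "\<dots> = 1 \<longleftrightarrow> (f u, f v) \<in> parcs (path_graph m \<box> path_graph n)"
      using * by (simp add: cartesian_product_def path_graph_def) linarith
    finally show ?thesis
      by simp
  qed
  have arcs_sub: "parcs (path_graph m \<box> path_graph n) \<subseteq> ({..<m} \<times> {..<n}) \<times> ({..<m} \<times> {..<n})"
    by (auto simp: cartesian_product_def path_graph_def)
  have arcs_eq: "map_prod f f ` arcs ?G = parcs (path_graph m \<box> path_graph n)"
  proof (intro subset_antisym subsetI)
    fix e assume e: "e \<in> parcs (path_graph m \<box> path_graph n)"
    then have "e \<in> (f ` ?R) \<times> (f ` ?R)"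
      using arcs_sub unfolding verts_eq by blast
    then obtain u v where uv: "e = (f u, f v)" "u \<in> ?R" "v \<in> ?R"
      by blast
    then have "(u, v) \<in> arcs ?G"
      using e adj unfolding arcs by blast
    then show "e \<in> map_prod f f ` arcs ?G"
      using uv(1) by force
  next
    fix e assume "e \<in> map_prod f f ` arcs ?G"
    then obtain u v where "e = (f u, f v)" "u \<in> ?R" "v \<in> ?R" "l1_dist u v = 1"
      unfolding arcs by blast
    then show "e \<in> parcs (path_graph m \<box> path_graph n)"
      using adj by simp
  qed
  have "pre_digraph.digraph_isomorphism ?G h"
    unfolding pre_digraph.digraph_isomorphism_def
  proof (intro conjI)
    show "wf_digraph ?G"
      by (rule Lambda2.wellformed_induce_subgraph)
    show "inj_on (iso_verts h) (verts ?G)"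
      using inj by (simp add: h_def)
    have "inj_on (map_prod f f) (arcs ?G)"
      using map_prod_inj_on[OF inj inj] by (rule inj_on_subset) (auto simp: arcs)
    then show "inj_on (iso_arcs h) (arcs ?G)"
      by (simp add: h_def)
  qed (auto simp: h_def)
  moreover have "with_proj (path_graph m \<box> path_graph n) = app_iso h ?G"
    unfolding app_iso_def with_proj_def[of "path_graph m \<box> path_graph n"]
    using verts_eq arcs_eq
    by (simp add: h_def) (simp add: cartesian_product_def path_graph_def)
  ultimately show ?thesis
    unfolding digraph_iso_def by blast
qed

section \<open>The tiling\<close>

text \<open>Blocks whose \<open>p\<close> differ by 2 have \<open>2 * t\<close> free columns between
  them, \<open>t\<close> for each neighbourhood; consecutive rows of blocks are \<open>t\<close>
  free rows apart.\<close>

definition block :: "nat \<Rightarrow> nat \<Rightarrow> int \<times> int \<Rightarrow> (int \<times> int) set" where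
  "block t k = (\<lambda>(p, n). {p * (int t + 1)..p * (int t + 1) + 1} \<times>
     {n * (int k + int t)..n * (int k + int t) + int k - 1})"

text \<open>The graph distance to a block in closed form (see \<open>graph_setdist_block\<close>),
  so that the tiling becomes a statement about integers.\<close>

definition block_dist :: "nat \<Rightarrow> nat \<Rightarrow> int \<times> int \<Rightarrow> int \<times> int \<Rightarrow> int" where
  "block_dist t k v = (\<lambda>(p, n).
     interval_dist (p * (int t + 1)) (p * (int t + 1) + 1) (fst v) +
     interval_dist (n * (int k + int t)) (n * (int k + int t) + int k - 1) (snd v))"

definition even_sum_lattice :: "(int \<times> int) set" where
  "even_sum_lattice = {(p, n). even (p + n)}"

section \<open>Distances to the columns and rows of blocks\<close>

lemma interval_dist_nonneg: "0 \<le> interval_dist a c x"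
  by (simp add: interval_dist_def)

lemma period_decomposition:
  fixes x L :: int
  assumes "0 < L"
  obtains a r where "x = a * L + r" "0 \<le> r" "r < L"
  using that[of "x div L" "x mod L"] assms by simp

text \<open>Bounds on the product \<open>p * L\<close> itself, so that linear arithmetic can treat
  it as an atom when showing that all other columns or rows are too far away.\<close>

lemma multiple_cases:
  fixes a p L :: int
  assumes "0 < L"
  shows "p * L \<le> a * L - L \<or> p = a \<or> p = a + 1 \<or> a * L + 2 * L \<le> p * L"
proof -
  consider "p \<le> a - 1" | "p = a" | "p = a + 1" | "a + 2 \<le> p"
    by linarith
  then show ?thesis
  proof cases
    case 1
    then have "p * L \<le> (a - 1) * L" using assms by simp
    then show ?thesis by (simp add: algebra_simps)
  next
    case 4
    then have "(a + 2) * L \<le> p * L" using assms by simp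
    then show ?thesis by (simp add: algebra_simps)
  qed auto
qed

text \<open>
  Of the two columns \<open>a\<close> and \<open>a + 1\<close>, one carries blocks in even rows only and the other in odd rows only;
  that the two distances add up to \<open>t\<close> is why the zigzags of consecutive rows fit together.
\<close>

lemma horizontal_dist:
  obtains a f where "0 \<le> f" "f \<le> int t"
    "interval_dist (a * (int t + 1)) (a * (int t + 1) + 1) x = f"
    "interval_dist ((a + 1) * (int t + 1)) ((a + 1) * (int t + 1) + 1) x = int t - f"
    "\<And>p. p \<noteq> a \<Longrightarrow> p \<noteq> a + 1 \<Longrightarrow>
      int t < interval_dist (p * (int t + 1)) (p * (int t + 1) + 1) x"
proof -
  \<comment> \<open>The shift by 1 measures from the right end \<open>a * (int t + 1) + 1\<close> of
    column \<open>a\<close>, so the remainder \<open>r\<close> is the distance to that column, and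
    \<open>t - r\<close> is left to the next one.\<close>
  obtain a r where "x - 1 = a * (int t + 1) + r" "0 \<le> r" "r < int t + 1"
    by (rule period_decomposition[of "int t + 1" "x - 1"]) auto
  then have x: "x = a * (int t + 1) + 1 + r" "0 \<le> r" "r \<le> int t"
    by auto
  have "interval_dist (a * (int t + 1)) (a * (int t + 1) + 1) x = r"
    using x by (auto simp: interval_dist_def)
  moreover have "interval_dist ((a + 1) * (int t + 1)) ((a + 1) * (int t + 1) + 1) x = int t - r"
    using x by (auto simp: interval_dist_def distrib_right)
  moreover have "int t < interval_dist (p * (int t + 1)) (p * (int t + 1) + 1) x"
    if "p \<noteq> a" "p \<noteq> a + 1" for p
    using multiple_cases[of "int t + 1" p a] that x
    by (auto simp: interval_dist_def)
  ultimately show ?thesis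
    using that x by blast
qed

text \<open>Either \<open>y\<close> lies within the \<open>k\<close> rows of block row
  \<open>b\<close>, so \<open>e = 0\<close> and the next block row is at distance at least
  \<open>t + 1\<close>, or \<open>y\<close> lies in the gap of \<open>t\<close> rows, where the two
  distances add up to \<open>t + 1\<close>.\<close>

lemma vertical_dist:
  assumes "k \<ge> 1"
  obtains b e e' where "0 \<le> e" "e \<le> int t" "int t + 1 \<le> e + e'"
    "e = 0 \<or> e + e' = int t + 1"
    "interval_dist (b * (int k + int t)) (b * (int k + int t) + int k - 1) y = e"
    "interval_dist ((b + 1) * (int k + int t)) ((b + 1) * (int k + int t) + int k - 1) y = e'"
    "\<And>n. n \<noteq> b \<Longrightarrow> n \<noteq> b + 1 \<Longrightarrow>
      int t < interval_dist (n * (int k + int t)) (n * (int k + int t) + int k - 1) y"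
proof -
  have pos: "0 < int k + int t"
    using assms by simp
  obtain b s where y: "y = b * (int k + int t) + s" "0 \<le> s" "s < int k + int t"
    by (rule period_decomposition[OF pos])
  have "interval_dist (b * (int k + int t)) (b * (int k + int t) + int k - 1) y
      = max 0 (s - int k + 1)"
    using y assms by (auto simp: interval_dist_def)
  moreover have "interval_dist ((b + 1) * (int k + int t)) ((b + 1) * (int k + int t) + int k - 1) y
      = int k + int t - s"
    using y assms by (auto simp: interval_dist_def distrib_right)
  moreover have "int t < interval_dist (n * (int k + int t)) (n * (int k + int t) + int k - 1) y"
    if "n \<noteq> b" "n \<noteq> b + 1" for n
    using multiple_cases[OF pos, of n b] that y assms
    by (auto simp: interval_dist_def)
  moreover have "0 \<le> max 0 (s - int k + 1)" "max 0 (s - int k + 1) \<le> int t"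
    "int t + 1 \<le> max 0 (s - int k + 1) + (int k + int t - s)"
    "max 0 (s - int k + 1) = 0 \<or> max 0 (s - int k + 1) + (int k + int t - s) = int t + 1"
    using y assms by auto
  ultimately show ?thesis
    using that by blast
qed

text \<open>Only four blocks can be near \<open>v\<close>, and parity keeps a diagonal pair of them.
  The two distances of such a pair sum to \<open>t + e + e'\<close>, at least
  \<open>2 * t + 1\<close>, so at most one is \<open>\<le> t\<close>. If one exceeds
  \<open>t\<close>, then \<open>e > 0\<close>, the sum is exactly \<open>2 * t + 1\<close>, and the
  other is \<open>\<le> t\<close>.\<close>

lemma block_neighbourhoods_tile:
  assumes "k \<ge> 1"
  shows "\<exists>!q. q \<in> even_sum_lattice \<and> block_dist t k v q \<le> int t"
proof -
  let ?h = "\<lambda>p. interval_dist (p * (int t + 1)) (p * (int t + 1) + 1) (fst v)"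
  let ?v = "\<lambda>n. interval_dist (n * (int k + int t)) (n * (int k + int t) + int k - 1) (snd v)"
  obtain a f where f: "0 \<le> f" "f \<le> int t" and h: "?h a = f" "?h (a + 1) = int t - f"
    and h_far: "\<And>p. p \<noteq> a \<Longrightarrow> p \<noteq> a + 1 \<Longrightarrow> int t < ?h p"
    by (rule horizontal_dist[where t = t and x = "fst v"]) blast
  obtain b e e' where e: "0 \<le> e" "e \<le> int t" "int t + 1 \<le> e + e'" "e = 0 \<or> e + e' = int t + 1"
    and v: "?v b = e" "?v (b + 1) = e'"
    and v_far: "\<And>n. n \<noteq> b \<Longrightarrow> n \<noteq> b + 1 \<Longrightarrow> int t < ?v n"
    by (rule vertical_dist[OF assms, where t = t and y = "snd v"]) blast
  have near: "p \<in> {a, a + 1} \<and> n \<in> {b, b + 1}" if "?h p + ?v n \<le> int t" for p n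
  proof -
    have "?h p \<le> int t" "?v n \<le> int t"
      using that interval_dist_nonneg by (smt (verit))+
    then show ?thesis
      using h_far[of p] v_far[of n] by force
  qed
  \<comment> \<open>The conditions for column \<open>a + 1\<close> have \<open>t\<close> cancelled:
    \<open>e \<le> f\<close> stands for \<open>t - f + e \<le> t\<close>.\<close>
  have sol: "q \<in> even_sum_lattice \<and> block_dist t k v q \<le> int t \<longleftrightarrow>
      even (fst q + snd q) \<and> (q = (a, b) \<and> f + e \<le> int t \<or> q = (a + 1, b) \<and> e \<le> f \<or>
        q = (a, b + 1) \<and> f + e' \<le> int t \<or> q = (a + 1, b + 1) \<and> e' \<le> f)" for q
    using near[of "fst q" "snd q"] h v
    by (cases q) (auto simp: even_sum_lattice_def block_dist_def)
  consider "even (a + b)" "f + e \<le> int t" | "even (a + b)" "\<not> f + e \<le> int t"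
    | "odd (a + b)" "e \<le> f" | "odd (a + b)" "\<not> e \<le> f"
    by blast
  then show ?thesis
  proof cases
    case 1
    then show ?thesis
      unfolding sol by (intro ex1I[of _ "(a, b)"]) (use e f in auto)
  next
    case 2
    then show ?thesis
      unfolding sol by (intro ex1I[of _ "(a + 1, b + 1)"]) (use e f in auto)
  next
    case 3
    then show ?thesis
      unfolding sol by (intro ex1I[of _ "(a + 1, b)"]) (use e f in auto)
  next
    case 4
    then show ?thesis
      unfolding sol by (intro ex1I[of _ "(a, b + 1)"]) (use e f in auto)
  qed
qed

section \<open>From neighbourhoods of blocks to components of their union\<close>

lemma block_dist_le_l1_dist:
  assumes "w \<in> block t k q"
  shows "block_dist t k v q \<le> l1_dist v w"
  using assms by (auto simp: block_def block_dist_def interval_dist_def l1_dist_def split: prod.splits)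

lemma graph_setdist_block:
  assumes "k \<ge> 1"
  shows "graph_setdist (with_proj Lambda2) v (block t k q) = ereal (real_of_int (block_dist t k v q))"
  unfolding block_def block_dist_def prod.case_eq_if
  by (rule graph_setdist_rectangle) (use assms in auto)

lemma sccs_blocks:
  assumes "t \<ge> 1" "k \<ge> 1"
  shows "pre_digraph.sccs (with_proj Lambda2 \<restriction> (\<Union>q\<in>even_sum_lattice. block t k q)) =
    (\<lambda>q. with_proj Lambda2 \<restriction> block t k q) ` even_sum_lattice"
proof -
  let ?S = "\<Union>q\<in>even_sum_lattice. block t k q"
  have "pre_digraph.sccs (with_proj Lambda2 \<restriction> ?S) =
      (\<lambda>B. (with_proj Lambda2 \<restriction> ?S) \<restriction> B) ` block t k ` even_sum_lattice"
  proof (rule sccs_eq_blocks)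
    show "wf_digraph (with_proj Lambda2 \<restriction> ?S)"
      by (rule Lambda2.wellformed_induce_subgraph)
    show "{} \<notin> block t k ` even_sum_lattice"
      using assms by (auto simp: block_def dest!: sym[of "{}"])
    show "u \<rightarrow>\<^sup>*\<^bsub>with_proj Lambda2 \<restriction> ?S\<^esub> v"
      if "B \<in> block t k ` even_sum_lattice" "u \<in> B" "v \<in> B" for B u v
    proof -
      have "B \<subseteq> ?S"
        using that by blast
      then show ?thesis
        using that rectangle_reachable by (fastforce simp: block_def)
    qed
    show "v \<in> B" if B: "B \<in> block t k ` even_sum_lattice" "u \<in> B"
      and adj: "u \<rightarrow>\<^bsub>with_proj Lambda2 \<restriction> ?S\<^esub> v" for B u v
    proof -
      obtain q where q: "q \<in> even_sum_lattice" "B = block t k q"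
        using B by blast
      obtain q' where q': "q' \<in> even_sum_lattice" "v \<in> block t k q'" and uv: "l1_dist v u = 1"
        using adj by (auto simp: adj_induce_Lambda2_iff l1_dist_commute)
      \<comment> \<open>The point \<open>v\<close> is at distance at most 1 from block
        \<open>q\<close>, hence at most \<open>t\<close> as \<open>t \<ge> 1\<close>, and at
        distance 0 from its own block \<open>q'\<close>. Uniqueness in the tiling then identifies
        the two.\<close>
      have "block_dist t k v q \<le> int t" "block_dist t k v q' \<le> int t"
        using block_dist_le_l1_dist[of u t k q v] block_dist_le_l1_dist[of v t k q' v] q' q B uv assms
        by (auto simp: l1_dist_def)
      then have "q = q'"
        using block_neighbourhoods_tile[OF assms(2)] q q' by blast
      then show ?thesis
        using q q' by simp
    qed
  qed simp
  \<comment> \<open>Each block lies in \<open>?S\<close>, so inducing on \<open>?S\<close> first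
    changes nothing.\<close>
  also have "\<dots> = (\<lambda>q. with_proj Lambda2 \<restriction> block t k q) ` even_sum_lattice"
    unfolding image_image
    by (intro image_cong refl pre_digraph.equality) (auto simp: induce_subgraph_def)
  finally show ?thesis .
qed

theorem theorem9:
  fixes t k :: nat
  assumes "t \<ge> 1" and "k \<ge> 1"
  shows "\<exists>S :: (int \<times> int) set. PDDS (with_proj Lambda2) t S \<and>
    (\<forall>C \<in> pre_digraph.sccs (with_proj Lambda2 \<restriction> S).
       digraph_iso C (with_proj (path_graph 2 \<box> path_graph k)))"
proof (intro exI conjI)
  let ?S = "\<Union>q\<in>even_sum_lattice. block t k q"
  note sccs = sccs_blocks[OF assms]
  show "PDDS (with_proj Lambda2) t ?S"
    unfolding PDDS_def sccs
  proof (intro conjI ballI impI)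
    fix v :: "int \<times> int"
    obtain q where q: "q \<in> even_sum_lattice" "block_dist t k v q \<le> int t"
      and unique: "\<And>q'. q' \<in> even_sum_lattice \<Longrightarrow> block_dist t k v q' \<le> int t \<Longrightarrow> q' = q"
      using block_neighbourhoods_tile[OF assms(2), of t v] by blast
    \<comment> \<open>Passing from extended reals to integers lets the unique index \<open>q\<close>
      of the tiling yield the unique component.\<close>
    have near: "graph_setdist (with_proj Lambda2) v (block t k q') \<le> ereal (real t) \<longleftrightarrow>
        block_dist t k v q' \<le> int t" for q'
      unfolding graph_setdist_block[OF assms(2)] by simp linarith
    show "\<exists>!C. C \<in> (\<lambda>q. with_proj Lambda2 \<restriction> block t k q) ` even_sum_lattice \<and>
        graph_setdist (with_proj Lambda2) v (verts C) \<le> ereal (real t)"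
    proof (rule ex1I[of _ "with_proj Lambda2 \<restriction> block t k q"])
      show "with_proj Lambda2 \<restriction> block t k q \<in>
            (\<lambda>q. with_proj Lambda2 \<restriction> block t k q) ` even_sum_lattice \<and>
          graph_setdist (with_proj Lambda2) v (verts (with_proj Lambda2 \<restriction> block t k q))
            \<le> ereal (real t)"
        using q near by simp
    next
      fix C
      assume "C \<in> (\<lambda>q. with_proj Lambda2 \<restriction> block t k q) ` even_sum_lattice \<and>
        graph_setdist (with_proj Lambda2) v (verts C) \<le> ereal (real t)"
      then obtain q' where "q' \<in> even_sum_lattice" "C = with_proj Lambda2 \<restriction> block t k q'"
        "graph_setdist (with_proj Lambda2) v (block t k q') \<le> ereal (real t)"
        by auto
      then show "C = with_proj Lambda2 \<restriction> block t k q"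
        using unique near by blast
    qed
  next
    fix v C
    assume "C \<in> (\<lambda>q. with_proj Lambda2 \<restriction> block t k q) ` even_sum_lattice"
    then obtain q where "verts C = block t k q"
      by auto
    then show "\<exists>!w. w \<in> verts C \<and> graph_dist (with_proj Lambda2) v w =
        graph_setdist (with_proj Lambda2) v (verts C)"
      using assms(2) by (simp only: block_def prod.case_eq_if) (rule rectangle_unique_nearest; simp)
  qed simp
  show "\<forall>C \<in> pre_digraph.sccs (with_proj Lambda2 \<restriction> ?S).
      digraph_iso C (with_proj (path_graph 2 \<box> path_graph k))"
  proof
    fix C assume "C \<in> pre_digraph.sccs (with_proj Lambda2 \<restriction> ?S)"
    then obtain p n where "C = with_proj Lambda2 \<restriction> block t k (p, n)"
      unfolding sccs by auto
    then show "digraph_iso C (with_proj (path_graph 2 \<box> path_graph k))"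
      \<comment> \<open>With \<open>m = 2\<close> the upper end \<open>a + int m - 1\<close> becomes
        \<open>a + 1\<close>, the right column of the block.\<close>
      using rectangle_iso_path_product[of "p * (int t + 1)" 2 "n * (int k + int t)" k]
      by (simp add: block_def add.commute)
  qed
qed

end
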